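(* Let $\lambda=(\gamma_0,c_0)\in C_1$ have elliptic coordinates $(\varphi,k)$, let $s_1=\mathrm{sgn}(\cos(\gamma_0/2))$, and put $\varphi_t=\varphi+t$ and $w=\dfrac{1}{\mathrm{dn}\,\varphi-k\,\mathrm{cn}\,\varphi}$. Then the extremal trajectory $q_t=(x_t,y_t,z_t)$ with initial covector $\lambda$ and $q_0=(0,0,0)$ is given, for all $t\ge 0$, by $$x_t=\frac{s_1}{2}\left[\left(w+\frac{1}{w(1-k^2)}\right)\left[\mathrm{E}(\varphi_t)-\mathrm{E}(\varphi)\right]+\left(\frac{k}{w(1-k^2)}-kw\right)\left[\mathrm{sn}\,\varphi_t-\mathrm{sn}\,\varphi\right]\right],$$ $$y_t=\frac{1}{2}\left[\left(w-\frac{1}{w(1-k^2)}\right)\left[\mathrm{E}(\varphi_t)-\mathrm{E}(\varphi)\right]-\left(\frac{k}{w(1-k^2)}+kw\right)\left[\mathrm{sn}\,\varphi_t-\mathrm{sn}\,\varphi\right]\right],$$ $$z_t=s_1\ln\left[(\mathrm{dn}\,\varphi_t-k\,\mathrm{cn}\,\varphi_t)\,w\right].$$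
   Context: Setting: $M=\mathrm{SH}(2)$ is the Lie group of matrices $\begin{pmatrix}\cosh z&\sinh z&x\\ \sinh z&\cosh z&y\\0&0&1\end{pmatrix}$, identified with $\mathbb{R}^3$ via $(x,y,z)$ (identity $=(0,0,0)$), with the left-invariant sub-Riemannian structure having orthonormal frame $f_1=\cosh z\,\partial_x+\sinh z\,\partial_y$, $f_2=\partial_z$. Its arc-length parametrized normal extremals starting at the identity, given by the Pontryagin Maximum Principle, are described as follows. The phase cylinder is $C=(\mathbb{R}/4\pi\mathbb{Z})\times\mathbb{R}\ni(\gamma,c)$. For $\lambda=(\gamma_0,c_0)\in C$, let $(\gamma_t,c_t,x_t,y_t,z_t)$ solve $$\dot\gamma=c,\quad \dot c=-\sin\gamma,\quad \dot x=\cos\tfrac{\gamma}{2}\cosh z,\quad \dot y=\cos\tfrac{\gamma}{2}\sinh z,\quad \dot z=\sin\tfrac{\gamma}{2},$$ with initial values $(\gamma_0,c_0)$ and $x_0=y_0=z_0=0$. The curve $q_t=(x_t,y_t,z_t)$ is the extremal trajectory with initial covector $\lambda$. The pendulum energy is $E=\frac{c^2}{2}-\cos\gamma$, and $C_1=\{(\gamma,c)\in C: E\in(-1,1)\}$. Elliptic coordinates $(\varphi,k)$ on $C_1$: $k=\sqrt{\frac{E+1}{2}}=\sqrt{\sin^2\frac{\gamma}{2}+\frac{c^2}{4}}\in(0,1)$, and $\varphi$ (defined modulo $4K(k)$) is determined by $\sin\frac{\gamma}{2}=s_1k\,\mathrm{sn}(\varphi,k)$, $\cos\frac{\gamma}{2}=s_1\,\mathrm{dn}(\varphi,k)$,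 $\frac{c}{2}=k\,\mathrm{cn}(\varphi,k)$, where $s_1=\mathrm{sgn}(\cos\frac{\gamma}{2})$. Here $\mathrm{sn},\mathrm{cn},\mathrm{dn}$ are the Jacobi elliptic functions with modulus $k$ (so $\mathrm{sn}\,\varphi=\mathrm{sn}(\varphi,k)$, and $\mathrm{dn}^2=1-k^2\mathrm{sn}^2$), $K(k)$ is the complete elliptic integral of the first kind, and $\mathrm{E}(\varphi)=\mathrm{E}(\varphi,k)=\int_0^{\varphi}\mathrm{dn}^2(t,k)\,dt$. *)

theory Defs
  imports "HOL-Analysis.Analysis" "HOL-Library.Real_Mod"
begin

text \<open>
  The elliptic functions below are meant for a modulus \<open>0 \<le> k < 1\<close>; then \<open>ell_F k\<close> is an
  increasing bijection of the real line and the description in \<open>jacobi_am\<close> is uniquely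
  satisfied. The integrals are oriented, so negative arguments are covered.
\<close>

definition ell_F :: "real \<Rightarrow> real \<Rightarrow> real" where
  "ell_F k \<theta> = (LBINT s=0..\<theta>. 1 / sqrt (1 - k\<^sup>2 * (sin s)\<^sup>2))"

definition jacobi_am :: "real \<Rightarrow> real \<Rightarrow> real" where
  "jacobi_am u k = (THE \<theta>. ell_F k \<theta> = u)"

definition jacobi_sn :: "real \<Rightarrow> real \<Rightarrow> real" where
  "jacobi_sn u k = sin (jacobi_am u k)"

definition jacobi_cn :: "real \<Rightarrow> real \<Rightarrow> real" where
  "jacobi_cn u k = cos (jacobi_am u k)"

definition jacobi_dn :: "real \<Rightarrow> real \<Rightarrow> real" where
  "jacobi_dn u k = sqrt (1 - k\<^sup>2 * (jacobi_sn u k)\<^sup>2)"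

definition jacobi_E :: "real \<Rightarrow> real \<Rightarrow> real" where
  "jacobi_E u k = (LBINT s=0..u. (jacobi_dn s k)\<^sup>2)"

text \<open>
  A point of the cylinder \<open>(\<real> / 4\<pi>\<int>) \<times> \<real>\<close> is given by a pair of reals
  \<open>(\<gamma>, c)\<close>, with \<open>\<gamma>\<close> an arbitrary representative of its class modulo \<open>4\<pi>\<close>. All
  notions below are invariant under \<open>\<gamma> \<mapsto> \<gamma> + 4\<pi>\<close>.
\<close>

definition pendulum_energy :: "real \<Rightarrow> real \<Rightarrow> real" where
  "pendulum_energy \<gamma> c = c\<^sup>2 / 2 - cos \<gamma>"

definition C1 :: "(real \<times> real) set" where
  "C1 = {(\<gamma>, c). -1 < pendulum_energy \<gamma> c \<and> pendulum_energy \<gamma> c < 1}"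

text \<open>
  \<open>\<phi>\<close> is only determined modulo \<open>4K(k)\<close>: the predicate accepts every
  representative.
\<close>

definition elliptic_coordinates :: "real \<Rightarrow> real \<Rightarrow> real \<Rightarrow> real \<Rightarrow> bool" where
  "elliptic_coordinates \<gamma> c \<phi> k \<longleftrightarrow>
     k = sqrt ((pendulum_energy \<gamma> c + 1) / 2) \<and>
     sin (\<gamma> / 2) = sgn (cos (\<gamma> / 2)) * k * jacobi_sn \<phi> k \<and>
     cos (\<gamma> / 2) = sgn (cos (\<gamma> / 2)) * jacobi_dn \<phi> k \<and>
     c / 2 = k * jacobi_cn \<phi> k"

text \<open>
  Here \<open>\<gamma>\<close> is a lift to \<open>\<real>\<close> of the first component of the vertical part, a curve in
  \<open>\<real> / 4\<pi>\<int>\<close>; accordingly its initial value is prescribed modulo \<open>4\<pi>\<close> only.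
  The system is considered on \<open>[0, \<infinity>)\<close>, with one-sided derivatives at 0.
\<close>

definition extremal_solution ::
  "real \<Rightarrow> real \<Rightarrow> (real \<Rightarrow> real) \<Rightarrow> (real \<Rightarrow> real) \<Rightarrow>
   (real \<Rightarrow> real) \<Rightarrow> (real \<Rightarrow> real) \<Rightarrow> (real \<Rightarrow> real) \<Rightarrow> bool" where
  "extremal_solution \<gamma>0 c0 \<gamma> c x y z \<longleftrightarrow>
     [\<gamma> 0 = \<gamma>0] (rmod (4 * pi)) \<and> c 0 = c0 \<and> x 0 = 0 \<and> y 0 = 0 \<and> z 0 = 0 \<and>
     (\<forall>t\<ge>0.
        (\<gamma> has_real_derivative c t) (at t within {0..}) \<and>
        (c has_real_derivative - sin (\<gamma> t)) (at t within {0..}) \<and>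
        (x has_real_derivative cos (\<gamma> t / 2) * cosh (z t)) (at t within {0..}) \<and>
        (y has_real_derivative cos (\<gamma> t / 2) * sinh (z t)) (at t within {0..}) \<and>
        (z has_real_derivative sin (\<gamma> t / 2)) (at t within {0..}))"

definition extremal_trajectory ::
  "real \<Rightarrow> real \<Rightarrow> (real \<Rightarrow> real) \<Rightarrow> (real \<Rightarrow> real) \<Rightarrow> (real \<Rightarrow> real) \<Rightarrow> bool" where
  "extremal_trajectory \<gamma>0 c0 x y z \<longleftrightarrow> (\<exists>\<gamma> c. extremal_solution \<gamma>0 c0 \<gamma> c x y z)"

end

theory Submission
  imports Defs
begin

text \<open>
  The vertical part of the system is the pendulum, and the elliptic coordinates rectify it: along
  \<open>\<phi> + t\<close>, the Jacobi functions give an explicit solution with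
  \<open>sin (\<gamma> / 2) = s1 k sn\<close>, \<open>cos (\<gamma> / 2) = s1 dn\<close> and \<open>c = 2 k cn\<close>. The horizontal part is then
  a chain of quadratures. First, \<open>z' = s1 k sn\<close> is the derivative of \<open>s1 ln (dn - k cn)\<close>. Second,
  the identity \<open>(dn - k cn) (dn + k cn) = 1 - k\<^sup>2\<close> turns \<open>exp (- s1 z)\<close> into a linear expression in
  \<open>dn\<close> and \<open>cn\<close>, as \<open>exp (s1 z)\<close> is. Hence \<open>x' = s1 dn cosh z\<close> and \<open>y' = s1 dn sinh z\<close> are linear
  combinations of \<open>dn\<^sup>2\<close> and \<open>cn dn\<close>, which are the derivatives of \<open>E\<close> and \<open>sn\<close>. This is
  \<open>explicit_extremal_trajectory\<close>.

  Conversely, every extremal trajectory with the given covector is this one, because the right-hand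
  side of the pendulum is globally Lipschitz: a Gronwall estimate (\<open>pendulum_unique\<close>) determines
  \<open>\<gamma>\<close> on \<open>[0, \<infinity>)\<close>, and then \<open>z\<close>, \<open>x\<close>, \<open>y\<close> are determined by their derivatives
  (\<open>extremal_trajectory_unique\<close>). What remains is the calculus of the Jacobi functions, which rests
  on the fact that the incomplete elliptic integral has derivative at least \<open>1\<close> and is therefore
  invertible with a differentiable inverse.
\<close>

section \<open>Jacobi elliptic functions\<close>

lemma one_minus_modulus_sin_pos:
  fixes k :: real
  assumes "k\<^sup>2 < 1"
  shows "0 < 1 - k\<^sup>2 * (sin s)\<^sup>2"
proof -
  have "k\<^sup>2 * (sin s)\<^sup>2 \<le> k\<^sup>2 * 1"
    by (intro mult_left_mono) (auto simp: abs_square_le_1)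
  then show ?thesis using assms by simp
qed

lemma DERIV_oriented_integral:
  fixes f :: "real \<Rightarrow> real"
  assumes "continuous_on UNIV f"
  shows "((\<lambda>u. LBINT s=0..u. f s) has_real_derivative f x) (at x)"
proof -
  define a b where "a = min 0 x - 1" and "b = max 0 x + 1"
  have "((\<lambda>u. LBINT s=ereal 0..u. f s) has_vector_derivative f x) (at x within {a..b})"
    by (rule interval_integral_FTC2)
      (auto simp: a_def b_def intro: continuous_on_subset[OF assms])
  moreover have "at x within {a..b} = at x"
    by (rule at_within_Icc_at) (auto simp: a_def b_def)
  ultimately show ?thesis
    by (simp add: has_real_derivative_iff_has_vector_derivative zero_ereal_def)
qed

lemma DERIV_ell_F:
  assumes "k\<^sup>2 < 1"
  shows "(ell_F k has_real_derivative 1 / sqrt (1 - k\<^sup>2 * (sin x)\<^sup>2)) (at x)"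
proof -
  have "continuous_on UNIV (\<lambda>s. 1 / sqrt (1 - k\<^sup>2 * (sin s)\<^sup>2))"
    using one_minus_modulus_sin_pos[OF assms]
    by (intro continuous_intros) (auto simp: less_imp_neq[THEN not_sym])
  from DERIV_oriented_integral[OF this] show ?thesis
    unfolding ell_F_def by simp
qed

text \<open>
  The integrand of the elliptic integral is at least \<open>1\<close>. This single estimate yields
  injectivity, surjectivity, and continuity of the inverse.
\<close>

lemma ell_F_expanding:
  assumes "k\<^sup>2 < 1" "a \<le> b"
  shows "b - a \<le> ell_F k b - ell_F k a"
proof -
  have "ell_F k a - a \<le> ell_F k b - b"
  proof (rule DERIV_nonneg_imp_nondecreasing[OF assms(2)])
    fix x
    let ?r = "sqrt (1 - k\<^sup>2 * (sin x)\<^sup>2)"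
    have "0 < ?r" "?r \<le> 1"
      using one_minus_modulus_sin_pos[OF assms(1), of x] by auto
    then have "0 \<le> 1 / ?r - 1" by simp
    moreover have "((\<lambda>x. ell_F k x - x) has_real_derivative 1 / ?r - 1) (at x)"
      by (intro derivative_intros DERIV_ell_F assms(1))
    ultimately show "\<exists>y. ((\<lambda>x. ell_F k x - x) has_real_derivative y) (at x) \<and> 0 \<le> y"
      by blast
  qed
  then show ?thesis by simp
qed

lemma ell_F_0: "ell_F k 0 = 0"
  by (simp add: ell_F_def zero_ereal_def)

lemma bij_ell_F:
  assumes k: "k\<^sup>2 < 1"
  shows "bij (ell_F k)"
proof (rule bijI)
  show "inj (ell_F k)"
  proof (rule linorder_injI)
    fix a b :: real
    assume "a < b"
    then show "ell_F k a \<noteq> ell_F k b"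
      using ell_F_expanding[OF k, of a b] by auto
  qed
  show "surj (ell_F k)"
    unfolding surj_def
  proof
    fix u :: real
    let ?m = "\<bar>u\<bar>"
    have "u \<le> ell_F k ?m" "ell_F k (- ?m) \<le> u"
      using ell_F_expanding[OF k, of 0 ?m] ell_F_expanding[OF k, of "- ?m" 0] by (auto simp: ell_F_0)
    moreover have "continuous_on {- ?m..?m} (ell_F k)"
      by (intro continuous_at_imp_continuous_on ballI DERIV_isCont[OF DERIV_ell_F[OF k]])
    ultimately show "\<exists>x. u = ell_F k x"
      using IVT'[of "ell_F k" "- ?m" u ?m] by auto
  qed
qed

lemma ell_F_jacobi_am:
  assumes "k\<^sup>2 < 1"
  shows "ell_F k (jacobi_am u k) = u"
  unfolding jacobi_am_def
  by (rule theI') (use bij_ell_F[OF assms] in \<open>simp add: bij_iff\<close>)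

lemma isCont_jacobi_am:
  assumes k: "k\<^sup>2 < 1"
  shows "isCont (\<lambda>u. jacobi_am u k) u"
proof -
  have "dist (jacobi_am u k) (jacobi_am v k) \<le> 1 * dist u v" for u v
    using ell_F_expanding[OF k, of "jacobi_am u k" "jacobi_am v k"]
      ell_F_expanding[OF k, of "jacobi_am v k" "jacobi_am u k"]
    by (cases "jacobi_am u k \<le> jacobi_am v k") (auto simp: ell_F_jacobi_am[OF k] dist_real_def)
  then have "1-lipschitz_on UNIV (\<lambda>u. jacobi_am u k)"
    by (intro lipschitz_onI) auto
  then have "continuous_on UNIV (\<lambda>u. jacobi_am u k)"
    by (rule lipschitz_on_continuous_on)
  then show ?thesis by (simp add: continuous_on_eq_continuous_at)
qed

lemma jacobi_dn_pos:
  assumes "k\<^sup>2 < 1"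
  shows "0 < jacobi_dn u k"
  using one_minus_modulus_sin_pos[OF assms] by (simp add: jacobi_dn_def jacobi_sn_def)

lemma jacobi_dn_square:
  assumes "k\<^sup>2 < 1"
  shows "(jacobi_dn u k)\<^sup>2 = 1 - k\<^sup>2 * (jacobi_sn u k)\<^sup>2"
  using one_minus_modulus_sin_pos[OF assms] by (simp add: jacobi_dn_def jacobi_sn_def less_imp_le)

lemma jacobi_cn_square: "(jacobi_cn u k)\<^sup>2 = 1 - (jacobi_sn u k)\<^sup>2"
  by (simp add: jacobi_cn_def jacobi_sn_def cos_squared_eq)

lemma DERIV_jacobi_am:
  assumes k: "k\<^sup>2 < 1"
  shows "((\<lambda>u. jacobi_am u k) has_real_derivative jacobi_dn u k) (at u)"
proof -
  have "((\<lambda>u. jacobi_am u k) has_real_derivative inverse (1 / jacobi_dn u k)) (at u)"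
  proof (rule DERIV_inverse_function[where f = "ell_F k" and a = "u - 1" and b = "u + 1"])
    show "(ell_F k has_real_derivative 1 / jacobi_dn u k) (at (jacobi_am u k))"
      using DERIV_ell_F[OF k] by (simp add: jacobi_dn_def jacobi_sn_def)
    show "1 / jacobi_dn u k \<noteq> 0"
      using jacobi_dn_pos[OF k, of u] by simp
  qed (auto simp: ell_F_jacobi_am[OF k] isCont_jacobi_am[OF k])
  then show ?thesis by simp
qed

lemma DERIV_jacobi_sn_at:
  assumes "k\<^sup>2 < 1"
  shows "((\<lambda>u. jacobi_sn u k) has_real_derivative jacobi_cn u k * jacobi_dn u k) (at u)"
  unfolding jacobi_sn_def jacobi_cn_def
  by (rule DERIV_chain2[OF DERIV_sin DERIV_jacobi_am[OF assms]])

lemma DERIV_jacobi_cn_at: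
  assumes "k\<^sup>2 < 1"
  shows "((\<lambda>u. jacobi_cn u k) has_real_derivative - jacobi_sn u k * jacobi_dn u k) (at u)"
  unfolding jacobi_sn_def jacobi_cn_def
  by (rule DERIV_chain2[OF DERIV_cos DERIV_jacobi_am[OF assms]])

lemma DERIV_jacobi_dn_at:
  assumes k: "k\<^sup>2 < 1"
  shows "((\<lambda>u. jacobi_dn u k) has_real_derivative - k\<^sup>2 * jacobi_sn u k * jacobi_cn u k) (at u)"
proof -
  have pos: "0 < 1 - k\<^sup>2 * (jacobi_sn u k)\<^sup>2"
    using one_minus_modulus_sin_pos[OF k] by (simp add: jacobi_sn_def)
  have "((\<lambda>u. sqrt (1 - k\<^sup>2 * (jacobi_sn u k)\<^sup>2)) has_real_derivative
      - (k\<^sup>2 * (2 * jacobi_sn u k * (jacobi_cn u k * jacobi_dn u k))) *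
        (inverse (jacobi_dn u k) / 2)) (at u)"
    using pos by (auto intro!: derivative_eq_intros DERIV_jacobi_sn_at[OF k] simp: jacobi_dn_def)
  then show ?thesis
    using jacobi_dn_pos[OF k, of u] by (simp add: jacobi_dn_def[symmetric] field_simps)
qed

lemma DERIV_jacobi_E_at:
  assumes "k\<^sup>2 < 1"
  shows "((\<lambda>u. jacobi_E u k) has_real_derivative (jacobi_dn u k)\<^sup>2) (at u)"
  unfolding jacobi_E_def
  by (rule DERIV_oriented_integral)
    (intro continuous_intros continuous_at_imp_continuous_on ballI
      DERIV_isCont[OF DERIV_jacobi_dn_at[OF assms]])

lemmas DERIV_jacobi_sn [derivative_intros] = DERIV_chain2[OF DERIV_jacobi_sn_at]
  and DERIV_jacobi_cn [derivative_intros] = DERIV_chain2[OF DERIV_jacobi_cn_at]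
  and DERIV_jacobi_dn [derivative_intros] = DERIV_chain2[OF DERIV_jacobi_dn_at]
  and DERIV_jacobi_E [derivative_intros] = DERIV_chain2[OF DERIV_jacobi_E_at]

text \<open>
  As \<open>1 - k\<^sup>2 > 0\<close> and \<open>dn > 0\<close>, both factors are positive. This gives meaning to \<open>w\<close> and the logarithm
  in \<open>z\<close>, and the reciprocal of \<open>dn - k cn\<close> is a multiple of \<open>dn + k cn\<close>.
\<close>

lemma jacobi_dn_cn_factorization:
  assumes "k\<^sup>2 < 1"
  shows "(jacobi_dn u k - k * jacobi_cn u k) * (jacobi_dn u k + k * jacobi_cn u k) = 1 - k\<^sup>2"
proof -
  have "(jacobi_dn u k - k * jacobi_cn u k) * (jacobi_dn u k + k * jacobi_cn u k)
      = (jacobi_dn u k)\<^sup>2 - k\<^sup>2 * (jacobi_cn u k)\<^sup>2"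
    by (simp add: algebra_simps power2_eq_square)
  then show ?thesis
    unfolding jacobi_dn_square[OF assms] jacobi_cn_square by (simp add: algebra_simps)
qed

lemma jacobi_dn_minus_cn_pos:
  assumes k: "k\<^sup>2 < 1"
  shows "0 < jacobi_dn u k - k * jacobi_cn u k"
proof -
  have "(k * jacobi_cn u k)\<^sup>2 < (jacobi_dn u k)\<^sup>2"
    using jacobi_dn_cn_factorization[OF k, of u] k by (simp add: algebra_simps power2_eq_square)
  then have "k * jacobi_cn u k < jacobi_dn u k"
    using jacobi_dn_pos[OF k, of u] by (rule power_less_imp_less_base[OF _ less_imp_le])
  then show ?thesis by simp
qed

section \<open>Uniqueness of extremal trajectories\<close>

lemma abs_sin_diff_le:
  fixes a b :: real
  shows "\<bar>sin a - sin b\<bar> \<le> \<bar>a - b\<bar>"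
proof -
  have "\<bar>sin a - sin b\<bar> = 2 * \<bar>sin ((a - b) / 2)\<bar> * \<bar>cos ((a + b) / 2)\<bar>"
    by (simp add: sin_diff_sin abs_mult)
  also have "\<dots> \<le> 2 * \<bar>(a - b) / 2\<bar> * 1"
    by (intro mult_mono abs_sin_x_le_abs_x) auto
  finally show ?thesis by simp
qed

lemma eq_on_nonneg_if_derivs_eq:
  fixes f g h :: "real \<Rightarrow> real"
  assumes "f 0 = g 0"
    and "\<And>t. 0 \<le> t \<Longrightarrow> (f has_real_derivative h t) (at t within {0..})"
    and "\<And>t. 0 \<le> t \<Longrightarrow> (g has_real_derivative h t) (at t within {0..})"
    and "0 \<le> t"
  shows "f t = g t"
proof -
  have "((\<lambda>t. f t - g t) has_real_derivative 0) (at t within {0..})" if "t \<in> {0..}" for t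
    using DERIV_diff[OF assms(2,3)] that by auto
  then obtain C where "\<forall>t\<in>{0..}. f t - g t = C"
    using has_field_derivative_zero_constant[of "{0::real..}" "\<lambda>t. f t - g t"] by auto
  then have "f 0 - g 0 = C" "f t - g t = C" using assms(4) by auto
  then show ?thesis using assms(1) by simp
qed

text \<open>
  The squared distance \<open>D\<close> of two solutions satisfies \<open>D' \<le> 2 D\<close>, as the sine is
  1-Lipschitz; so \<open>D exp (- 2 t)\<close> is nonnegative, nonincreasing and initially zero.
\<close>

lemma pendulum_unique:
  fixes \<gamma> c \<gamma>' c' :: "real \<Rightarrow> real"
  assumes init: "\<gamma> 0 = \<gamma>' 0" "c 0 = c' 0"
    and "\<And>t. 0 \<le> t \<Longrightarrow> (\<gamma> has_real_derivative c t) (at t within {0..})"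
    and "\<And>t. 0 \<le> t \<Longrightarrow> (c has_real_derivative - sin (\<gamma> t)) (at t within {0..})"
    and "\<And>t. 0 \<le> t \<Longrightarrow> (\<gamma>' has_real_derivative c' t) (at t within {0..})"
    and "\<And>t. 0 \<le> t \<Longrightarrow> (c' has_real_derivative - sin (\<gamma>' t)) (at t within {0..})"
    and t: "0 \<le> t"
  shows "\<gamma> t = \<gamma>' t"
proof -
  define D where "D t = (\<gamma> t - \<gamma>' t)\<^sup>2 + (c t - c' t)\<^sup>2" for t
  define D' where
    "D' t = 2 * (\<gamma> t - \<gamma>' t) * (c t - c' t) - 2 * (c t - c' t) * (sin (\<gamma> t) - sin (\<gamma>' t))" for t
  have deriv: "((\<lambda>t. D t * exp (- 2 * t)) has_real_derivative (D' s - 2 * D s) * exp (- 2 * s))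
      (at s within {0..})" if "0 \<le> s" for s
    unfolding D_def D'_def using that
    by (auto intro!: derivative_eq_intros assms simp: algebra_simps)
  have bound: "D' s \<le> 2 * D s" for s
  proof -
    let ?g = "\<bar>\<gamma> s - \<gamma>' s\<bar>" and ?c = "\<bar>c s - c' s\<bar>"
    have "(\<gamma> s - \<gamma>' s) * (c s - c' s) \<le> ?g * ?c"
      by (metis abs_ge_self abs_mult)
    moreover have "- ((c s - c' s) * (sin (\<gamma> s) - sin (\<gamma>' s))) \<le> ?c * ?g"
      by (rule order_trans[OF abs_ge_minus_self])
        (simp add: abs_mult mult_left_mono abs_sin_diff_le)
    moreover have "2 * (?g * ?c) \<le> ?g\<^sup>2 + ?c\<^sup>2"
      using sum_squares_bound[of ?g ?c] by (simp add: mult.assoc)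
    ultimately show ?thesis by (simp add: D_def D'_def algebra_simps)
  qed
  have "D t * exp (- 2 * t) \<le> D 0 * exp (- 2 * 0)"
  proof (rule DERIV_nonpos_imp_decreasing_open[OF t])
    fix s :: real
    assume s: "0 < s"
    then have "at s within {0..} = at s"
      by (intro at_within_interior) auto
    moreover have "(D' s - 2 * D s) * exp (- 2 * s) \<le> 0"
      using bound[of s] by (intro mult_nonpos_nonneg) auto
    ultimately show "\<exists>y. ((\<lambda>t. D t * exp (- 2 * t)) has_real_derivative y) (at s) \<and> y \<le> 0"
      using deriv[of s] s by auto
  next
    have "continuous_on {0..} (\<lambda>t. D t * exp (- 2 * t))"
      by (rule DERIV_continuous_on[OF deriv]) simp
    then show "continuous_on {0..t} (\<lambda>t. D t * exp (- 2 * t))"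
      by (rule continuous_on_subset) auto
  qed
  then have "D t \<le> 0" by (simp add: D_def init mult_le_0_iff)
  then show ?thesis
    by (simp add: D_def sum_power2_le_zero_iff)
qed

text \<open>
  The initial angles of two solutions may differ by a multiple of \<open>4\<pi>\<close>. Shifting one of them
  leaves the pendulum equation and the half-angle functions unchanged.
\<close>

lemma extremal_trajectory_unique:
  assumes "extremal_trajectory \<gamma>0 c0 x y z" "extremal_trajectory \<gamma>0 c0 x' y' z'"
    and t: "0 \<le> t"
  shows "x t = x' t" "y t = y' t" "z t = z' t"
proof -
  obtain \<gamma> c where sol: "extremal_solution \<gamma>0 c0 \<gamma> c x y z"
    using assms(1) by (auto simp: extremal_trajectory_def)
  obtain \<gamma>' c' where sol': "extremal_solution \<gamma>0 c0 \<gamma>' c' x' y' z'"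
    using assms(2) by (auto simp: extremal_trajectory_def)
  note S = sol[unfolded extremal_solution_def] and S' = sol'[unfolded extremal_solution_def]
  have "[\<gamma>' 0 = \<gamma> 0] (rmod (4 * pi))"
    using S S' rcong_sym rcong_trans by blast
  then obtain n :: int where n: "\<gamma> 0 = \<gamma>' 0 + of_int n * (4 * pi)"
    by (auto simp: rcong_altdef)
  let ?\<gamma> = "\<lambda>t. \<gamma>' t + of_int n * (4 * pi)"
  have sin_period: "sin (s + of_int n * (4 * pi)) = sin s" for s
    using sin.plus_of_int[of s "2 * n"] by (simp add: algebra_simps)
  have \<gamma>: "\<gamma> s = ?\<gamma> s" if "0 \<le> s" for s
  proof (rule pendulum_unique[of \<gamma> ?\<gamma> c c'])
    show "(?\<gamma> has_real_derivative c' t) (at t within {0..})" if "0 \<le> t" for t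
      using S' that by (auto intro!: derivative_eq_intros)
    show "(c' has_real_derivative - sin (?\<gamma> t)) (at t within {0..})" if "0 \<le> t" for t
      using S' that by (simp add: sin_period)
  qed (use S S' n that in auto)
  have half: "sin (\<gamma> s / 2) = sin (\<gamma>' s / 2)" "cos (\<gamma> s / 2) = cos (\<gamma>' s / 2)" if "0 \<le> s" for s
    using sin.plus_of_int[of "\<gamma>' s / 2" n] cos.plus_of_int[of "\<gamma>' s / 2" n] \<gamma>[OF that]
    by (simp_all add: add_divide_distrib algebra_simps)
  have z: "z s = z' s" if "0 \<le> s" for s
    by (rule eq_on_nonneg_if_derivs_eq[of z z' "\<lambda>s. sin (\<gamma> s / 2)"])
      (use S S' half that in auto)
  then show "z t = z' t" using t .
  show "x t = x' t"
    by (rule eq_on_nonneg_if_derivs_eq[of x x' "\<lambda>s. cos (\<gamma> s / 2) * cosh (z s)"])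
      (use S S' half z t in auto)
  show "y t = y' t"
    by (rule eq_on_nonneg_if_derivs_eq[of y y' "\<lambda>s. cos (\<gamma> s / 2) * sinh (z s)"])
      (use S S' half z t in auto)
qed

lemma extremal_trajectory_cong:
  assumes "extremal_trajectory \<gamma>0 c0 x' y' z'"
    and eq: "\<And>t. 0 \<le> t \<Longrightarrow> x t = x' t \<and> y t = y' t \<and> z t = z' t"
  shows "extremal_trajectory \<gamma>0 c0 x y z"
proof -
  have transfer: "(f has_real_derivative d) (at t within {0..})"
    if "(g has_real_derivative d) (at t within {0..})" "0 \<le> t" "\<And>s. 0 \<le> s \<Longrightarrow> f s = g s"
    for f g :: "real \<Rightarrow> real" and d t
    by (rule has_field_derivative_transform_within[OF that(1) zero_less_one]) (use that in auto)
  from assms(1) obtain \<gamma> c where "extremal_solution \<gamma>0 c0 \<gamma> c x' y' z'"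
    by (auto simp: extremal_trajectory_def)
  then have "extremal_solution \<gamma>0 c0 \<gamma> c x y z"
    unfolding extremal_solution_def using eq
    by (auto intro: transfer[of x'] transfer[of y'] transfer[of z'])
  then show ?thesis by (auto simp: extremal_trajectory_def)
qed

section \<open>The explicit trajectory\<close>

text \<open>
  The angle is \<open>2 arcsin (k sn)\<close>, with \<open>\<gamma> / 2\<close> moved to the opposite half of the circle by adding
  \<open>\<pi>\<close> when \<open>s1 = -1\<close>. Its derivative is \<open>2 k cn\<close> because the factor \<open>dn\<close> from the derivative of
  \<open>sn\<close> cancels against that of the arcsine.
\<close>

lemma explicit_pendulum_solution:
  fixes k \<phi> s1 :: real
  assumes k: "k\<^sup>2 < 1" and s1: "s1 = 1 \<or> s1 = - 1"
  obtains \<gamma> where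
    "\<And>t. sin (\<gamma> t / 2) = s1 * k * jacobi_sn (\<phi> + t) k"
    "\<And>t. cos (\<gamma> t / 2) = s1 * jacobi_dn (\<phi> + t) k"
    "\<And>t. (\<gamma> has_real_derivative 2 * k * jacobi_cn (\<phi> + t) k) (at t)"
proof -
  define a where "a t = arcsin (k * jacobi_sn (\<phi> + t) k)" for t
  define \<gamma> where "\<gamma> t = 2 * a t + (1 - s1) * pi" for t
  have "\<bar>k * jacobi_sn u k\<bar> < 1" for u
    using one_minus_modulus_sin_pos[OF k, of "jacobi_am u k"]
    by (simp add: jacobi_sn_def abs_square_less_1[symmetric] power_mult_distrib)
  then have bound: "- 1 < k * jacobi_sn u k" "k * jacobi_sn u k < 1" for u
    by (simp_all add: abs_less_iff minus_less_iff)
  have sin_a: "sin (a t) = k * jacobi_sn (\<phi> + t) k" for t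
    unfolding a_def by (rule sin_arcsin) (use bound less_imp_le in blast)+
  have cos_a: "cos (a t) = jacobi_dn (\<phi> + t) k" for t
    unfolding a_def
    by (subst cos_arcsin) (use bound less_imp_le in \<open>auto simp: jacobi_dn_def power_mult_distrib\<close>)
  show ?thesis
  proof
    fix t
    show "sin (\<gamma> t / 2) = s1 * k * jacobi_sn (\<phi> + t) k"
      "cos (\<gamma> t / 2) = s1 * jacobi_dn (\<phi> + t) k"
      using s1 by (auto simp: \<gamma>_def sin_a cos_a add_divide_distrib)
    have root: "sqrt (1 - (k * jacobi_sn (\<phi> + t) k)\<^sup>2) = jacobi_dn (\<phi> + t) k"
      by (simp add: jacobi_dn_def power_mult_distrib)
    have "(a has_real_derivative k * jacobi_cn (\<phi> + t) k) (at t)"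
      unfolding a_def using bound[of "\<phi> + t"] jacobi_dn_pos[OF k, of "\<phi> + t"] k
      by (auto intro!: derivative_eq_intros simp: root)
    then show "(\<gamma> has_real_derivative 2 * k * jacobi_cn (\<phi> + t) k) (at t)"
      unfolding \<gamma>_def by (auto intro!: derivative_eq_intros)
  qed
qed

text \<open>
  The factor \<open>w\<close> normalizes \<open>exp (s1 z)\<close> to \<open>1\<close> at time \<open>0\<close>, and the subtracted values at \<open>\<phi>\<close> make
  \<open>x\<close> and \<open>y\<close> vanish there; only the derivatives need work. As \<open>s1\<^sup>2 = 1\<close>, the even function
  \<open>cosh z\<close> does not see the sign \<open>s1\<close> in \<open>z\<close>, while \<open>sinh z\<close> contributes a second factor \<open>s1\<close> that
  cancels the one of \<open>cos (\<gamma> / 2)\<close>. This is why \<open>s1\<close> stands in front of \<open>x\<close> but not of \<open>y\<close>.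
\<close>

lemma explicit_extremal_trajectory:
  fixes \<gamma>0 c0 \<phi> k s1 w :: real
  assumes k: "k\<^sup>2 < 1" and s1: "s1 = 1 \<or> s1 = - 1"
    and sin0: "sin (\<gamma>0 / 2) = s1 * k * jacobi_sn \<phi> k"
    and cos0: "cos (\<gamma>0 / 2) = s1 * jacobi_dn \<phi> k"
    and c0: "c0 = 2 * k * jacobi_cn \<phi> k"
    and w: "w = 1 / (jacobi_dn \<phi> k - k * jacobi_cn \<phi> k)"
  shows "extremal_trajectory \<gamma>0 c0
    (\<lambda>t. s1 / 2 *
         ((w + 1 / (w * (1 - k\<^sup>2))) * (jacobi_E (\<phi> + t) k - jacobi_E \<phi> k)
          + (k / (w * (1 - k\<^sup>2)) - k * w) * (jacobi_sn (\<phi> + t) k - jacobi_sn \<phi> k)))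
    (\<lambda>t. 1 / 2 *
         ((w - 1 / (w * (1 - k\<^sup>2))) * (jacobi_E (\<phi> + t) k - jacobi_E \<phi> k)
          - (k / (w * (1 - k\<^sup>2)) + k * w) * (jacobi_sn (\<phi> + t) k - jacobi_sn \<phi> k)))
    (\<lambda>t. s1 * ln ((jacobi_dn (\<phi> + t) k - k * jacobi_cn (\<phi> + t) k) * w))"
    (is "extremal_trajectory _ _ ?x ?y ?z")
proof -
  obtain \<gamma> where sin_\<gamma>: "\<And>t. sin (\<gamma> t / 2) = s1 * k * jacobi_sn (\<phi> + t) k"
    and cos_\<gamma>: "\<And>t. cos (\<gamma> t / 2) = s1 * jacobi_dn (\<phi> + t) k"
    and deriv_\<gamma>: "\<And>t. (\<gamma> has_real_derivative 2 * k * jacobi_cn (\<phi> + t) k) (at t)"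
    using explicit_pendulum_solution[OF k s1] by blast
  define c where "c t = 2 * k * jacobi_cn (\<phi> + t) k" for t
  have w_pos: "0 < w" using jacobi_dn_minus_cn_pos[OF k] by (simp add: w)
  have s1_sq: "s1 * s1 = 1" using s1 by auto
  have "sin (\<gamma> 0 / 2) = sin (\<gamma>0 / 2) \<and> cos (\<gamma> 0 / 2) = cos (\<gamma>0 / 2)"
    using sin_\<gamma>[of 0] cos_\<gamma>[of 0] by (simp add: sin0 cos0)
  then obtain n :: int where "\<gamma> 0 / 2 = \<gamma>0 / 2 + 2 * pi * n"
    using sin_cos_eq_iff by blast
  then have "\<gamma>0 = \<gamma> 0 + of_int (- n) * (4 * pi)" by simp
  then have init: "[\<gamma> 0 = \<gamma>0] (rmod (4 * pi))"
    unfolding rcong_altdef by blast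
  have deriv_c: "(c has_real_derivative - sin (\<gamma> t)) (at t)" for t
  proof -
    have "sin (\<gamma> t) = 2 * sin (\<gamma> t / 2) * cos (\<gamma> t / 2)"
      using sin_double[of "\<gamma> t / 2"] by simp
    also have "\<dots> = (s1 * s1) * (2 * k * jacobi_sn (\<phi> + t) k * jacobi_dn (\<phi> + t) k)"
      by (simp add: sin_\<gamma> cos_\<gamma>)
    finally have "sin (\<gamma> t) = 2 * k * jacobi_sn (\<phi> + t) k * jacobi_dn (\<phi> + t) k"
      by (simp add: s1_sq)
    then show ?thesis
      unfolding c_def using k by (auto intro!: derivative_eq_intros)
  qed
  have deriv_z: "(?z has_real_derivative sin (\<gamma> t / 2)) (at t)" for t
  proof -
    note pos = jacobi_dn_minus_cn_pos[OF k, of "\<phi> + t"]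
    show ?thesis
      unfolding sin_\<gamma> using k pos w_pos
      by (auto intro!: derivative_eq_intros simp: field_simps power2_eq_square)
  qed
  have "exp (s1 * ?z t) = (jacobi_dn (\<phi> + t) k - k * jacobi_cn (\<phi> + t) k) * w"
    and "exp (- (s1 * ?z t)) = (jacobi_dn (\<phi> + t) k + k * jacobi_cn (\<phi> + t) k) / (w * (1 - k\<^sup>2))" for t
  proof -
    let ?m = "jacobi_dn (\<phi> + t) k - k * jacobi_cn (\<phi> + t) k"
      and ?p = "jacobi_dn (\<phi> + t) k + k * jacobi_cn (\<phi> + t) k"
    have m: "0 < ?m" by (rule jacobi_dn_minus_cn_pos[OF k])
    have "s1 * ?z t = ln (?m * w)"
      using s1_sq by (simp only: mult.assoc[symmetric] mult_1_left)
    then show "exp (s1 * ?z t) = ?m * w" using m w_pos by (simp only: exp_ln mult_pos_pos)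
    then have "exp (- (s1 * ?z t)) = 1 / (?m * w)"
      by (simp add: exp_minus inverse_eq_divide)
    also have "\<dots> = ?p / (w * (?m * ?p))"
    proof -
      have "?p \<noteq> 0"
        using jacobi_dn_cn_factorization[OF k, of "\<phi> + t"] k by auto
      then show ?thesis using m w_pos by (simp add: mult.commute)
    qed
    finally show "exp (- (s1 * ?z t)) = ?p / (w * (1 - k\<^sup>2))"
      by (simp only: jacobi_dn_cn_factorization[OF k])
  qed
  moreover have "cosh (?z t) = cosh (s1 * ?z t)" "sinh (?z t) = s1 * sinh (s1 * ?z t)" for t
    using s1 by auto
  ultimately have cosh_z: "cosh (?z t) =
      ((jacobi_dn (\<phi> + t) k - k * jacobi_cn (\<phi> + t) k) * w +
       (jacobi_dn (\<phi> + t) k + k * jacobi_cn (\<phi> + t) k) / (w * (1 - k\<^sup>2))) / 2"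
    and sinh_z: "sinh (?z t) = s1 * 
      (((jacobi_dn (\<phi> + t) k - k * jacobi_cn (\<phi> + t) k) * w -
       (jacobi_dn (\<phi> + t) k + k * jacobi_cn (\<phi> + t) k) / (w * (1 - k\<^sup>2))) / 2)" for t
    by (simp_all only: cosh_field_def sinh_field_def)
  have x_identity: "s1 * d * (((d - k * e) * a + (d + k * e) * b) / 2)
      = s1 / 2 * ((a + b) * d\<^sup>2 + (k * b - k * a) * (e * d))" for a b d e
    by (simp add: algebra_simps power2_eq_square add_divide_distrib diff_divide_distrib)
  have y_identity: "s1 * d * (s1 * (((d - k * e) * a - (d + k * e) * b) / 2))
      = 1 / 2 * ((a - b) * d\<^sup>2 - (k * b + k * a) * (e * d))" for a b d e
  proof -
    have "s1 * d * (s1 * (((d - k * e) * a - (d + k * e) * b) / 2))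
        = (s1 * s1) * (d * (((d - k * e) * a - (d + k * e) * b) / 2))"
      by (simp only: ac_simps)
    then show ?thesis
      by (simp add: s1_sq algebra_simps power2_eq_square add_divide_distrib diff_divide_distrib)
  qed
  have deriv_x: "(?x has_real_derivative cos (\<gamma> t / 2) * cosh (?z t)) (at t)" for t
  proof -
    have "(?x has_real_derivative s1 / 2 * ((w + 1 / (w * (1 - k\<^sup>2))) * (jacobi_dn (\<phi> + t) k)\<^sup>2
        + (k / (w * (1 - k\<^sup>2)) - k * w) * (jacobi_cn (\<phi> + t) k * jacobi_dn (\<phi> + t) k))) (at t)"
      by (rule derivative_eq_intros refl k | simp)+
    moreover have "cos (\<gamma> t / 2) * cosh (?z t) = s1 / 2 *
        ((w + 1 / (w * (1 - k\<^sup>2))) * (jacobi_dn (\<phi> + t) k)\<^sup>2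
        + (k / (w * (1 - k\<^sup>2)) - k * w) * (jacobi_cn (\<phi> + t) k * jacobi_dn (\<phi> + t) k))"
      unfolding cos_\<gamma> cosh_z
      using x_identity[of "jacobi_dn (\<phi> + t) k" "jacobi_cn (\<phi> + t) k" w "1 / (w * (1 - k\<^sup>2))"]
      by (simp only: times_divide_eq_right mult_1_right)
    ultimately show ?thesis by (simp only:)
  qed
  have deriv_y: "(?y has_real_derivative cos (\<gamma> t / 2) * sinh (?z t)) (at t)" for t
  proof -
    have "(?y has_real_derivative 1 / 2 * ((w - 1 / (w * (1 - k\<^sup>2))) * (jacobi_dn (\<phi> + t) k)\<^sup>2
        - (k / (w * (1 - k\<^sup>2)) + k * w) * (jacobi_cn (\<phi> + t) k * jacobi_dn (\<phi> + t) k))) (at t)"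
      by (rule derivative_eq_intros refl k | simp)+
    moreover have "cos (\<gamma> t / 2) * sinh (?z t) = 1 / 2 *
        ((w - 1 / (w * (1 - k\<^sup>2))) * (jacobi_dn (\<phi> + t) k)\<^sup>2
        - (k / (w * (1 - k\<^sup>2)) + k * w) * (jacobi_cn (\<phi> + t) k * jacobi_dn (\<phi> + t) k))"
      unfolding cos_\<gamma> sinh_z
      using y_identity[of "jacobi_dn (\<phi> + t) k" "jacobi_cn (\<phi> + t) k" w "1 / (w * (1 - k\<^sup>2))"]
      by (simp only: times_divide_eq_right mult_1_right)
    ultimately show ?thesis by (simp only:)
  qed
  have "?z 0 = 0"
    using jacobi_dn_minus_cn_pos[OF k, of \<phi>] by (simp add: w)
  then have "extremal_solution \<gamma>0 c0 \<gamma> c ?x ?y ?z"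
    unfolding extremal_solution_def
    using init deriv_\<gamma> deriv_c deriv_x deriv_y deriv_z
    by (auto simp: c_def c0 intro: has_field_derivative_at_within)
  then show ?thesis by (auto simp: extremal_trajectory_def)
qed

theorem theorem5p1:
  fixes \<gamma>0 c0 \<phi> k s1 w :: real and x y z :: "real \<Rightarrow> real"
  assumes "(\<gamma>0, c0) \<in> C1"
    and "elliptic_coordinates \<gamma>0 c0 \<phi> k"
    and "s1 = sgn (cos (\<gamma>0 / 2))"
    and "w = 1 / (jacobi_dn \<phi> k - k * jacobi_cn \<phi> k)"
  shows "extremal_trajectory \<gamma>0 c0 x y z \<longleftrightarrow>
    (\<forall>t\<ge>0.
       x t = s1 / 2 *
         ((w + 1 / (w * (1 - k\<^sup>2))) * (jacobi_E (\<phi> + t) k - jacobi_E \<phi> k)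
          + (k / (w * (1 - k\<^sup>2)) - k * w) * (jacobi_sn (\<phi> + t) k - jacobi_sn \<phi> k)) \<and>
       y t = 1 / 2 *
         ((w - 1 / (w * (1 - k\<^sup>2))) * (jacobi_E (\<phi> + t) k - jacobi_E \<phi> k)
          - (k / (w * (1 - k\<^sup>2)) + k * w) * (jacobi_sn (\<phi> + t) k - jacobi_sn \<phi> k)) \<and>
       z t = s1 * ln ((jacobi_dn (\<phi> + t) k - k * jacobi_cn (\<phi> + t) k) * w))"
proof -
  have energy: "- 1 < pendulum_energy \<gamma>0 c0" "pendulum_energy \<gamma>0 c0 < 1"
    using assms(1) by (auto simp: C1_def)
  note coords = assms(2)[unfolded elliptic_coordinates_def, folded assms(3)]
  have "k = sqrt ((pendulum_energy \<gamma>0 c0 + 1) / 2)"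
    using coords by (rule conjunct1)
  then have k: "k\<^sup>2 < 1"
    using energy by simp
  \<comment> \<open>At \<open>cos (\<gamma>0 / 2) = 0\<close> the energy is at least that of the unstable equilibrium, which is \<open>1\<close>.\<close>
  have "cos (\<gamma>0 / 2) \<noteq> 0"
  proof
    assume "cos (\<gamma>0 / 2) = 0"
    then have "cos \<gamma>0 = - 1" using cos_double_cos[of "\<gamma>0 / 2"] by simp
    then show False using energy(2) by (simp add: pendulum_energy_def)
  qed
  then have s1: "s1 = 1 \<or> s1 = - 1" by (auto simp: assms(3) sgn_if)
  note explicit = explicit_extremal_trajectory[OF k s1 _ _ _ assms(4), of \<gamma>0 c0]
  have "sin (\<gamma>0 / 2) = s1 * k * jacobi_sn \<phi> k" "cos (\<gamma>0 / 2) = s1 * jacobi_dn \<phi> k"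
    "c0 = 2 * k * jacobi_cn \<phi> k"
    using coords by argo+
  note explicit = explicit[OF this]
  show ?thesis
    using extremal_trajectory_unique[OF _ explicit] extremal_trajectory_cong[OF explicit] by blast
qed

end
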